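(* Let $n\ge2$. Every $SU(n)$-invariant 2-tensor $\tau\in\Gamma(\wedge^2T\mathbb{C}P^{n-1})$ on $\mathbb{C}P^{n-1}$ is a real constant multiple of the canonical $SU(n)$-invariant symplectic 2-tensor $\tilde\tau$ on $\mathbb{C}P^{n-1}$.
   Context: $SU(n)$ acts on $\mathbb{C}P^{n-1}$ in the standard way, and a 2-tensor (smooth bivector field) $\tau$ on $\mathbb{C}P^{n-1}$ is $SU(n)$-invariant if $L_u(\tau(x))=\tau(ux)$ for all $u\in SU(n)$ and $x\in\mathbb{C}P^{n-1}$, where $L_u$ is the map induced by the action of $u$. The canonical symplectic 2-tensor $\tilde\tau$ is the nondegenerate Poisson bivector field of the canonical $SU(n)$-invariant (Fubini-Study) symplectic structure of $\mathbb{C}P^{n-1}$. Explicitly (up to a constant factor), let $\phi:\mathbb{S}^{2n-1}\to\mathbb{C}P^{n-1}=\mathbb{S}^{2n-1}/\mathbb{T}$ be the quotient map by the diagonal action of the circle group $\mathbb{T}$, and for $p\in\mathbb{S}^{2n-1}\subset\mathbb{C}^n$ let $E_p=\{p,ip\}^\perp\subset T_p\mathbb{S}^{2n-1}$, a complex subspace of $\mathbb{C}^n$. Then $\tilde\tau(\phi(p))=(D\phi)_p\left(\sum_{j=1}^{n-1}f_j\wedge if_j\right)$ for any complex orthonormal basis $f_1,\dots,f_{n-1}$ of $E_p$. *)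

theory Defs
  imports "HOL-Analysis.Analysis"
begin

section \<open>Complex projective space as the quotient of the unit sphere by the circle\<close>

definition circle_related :: "complex^'n \<Rightarrow> complex^'n \<Rightarrow> bool" where
  "circle_related p q \<longleftrightarrow>
     norm p = 1 \<and> norm q = 1 \<and> (\<exists>c::complex. norm c = 1 \<and> q = c *s p)"

lemma norm_smult_complex: "norm (c *s (v::complex^'n)) = norm c * norm v"
  by (simp add: norm_vec_def L2_set_right_distrib norm_mult)

lemma circle_related_sym: "circle_related p q \<Longrightarrow> circle_related q p"
  unfolding circle_related_def
proof (elim conjE exE, intro conjI)
  fix c :: complex
  assume p: "norm p = 1" and q: "norm q = 1" and c: "norm c = 1" and qp: "q = c *s p"
  have "inverse c *s q = p"
    using c qp by (cases "c = 0") (auto simp: vector_smult_assoc)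
  then show "\<exists>c. norm c = 1 \<and> p = c *s q"
    using c by (intro exI[of _ "inverse c"]) (simp add: norm_inverse)
qed

lemma circle_related_trans:
  "circle_related p q \<Longrightarrow> circle_related q r \<Longrightarrow> circle_related p r"
  unfolding circle_related_def by (metis norm_mult vector_smult_assoc mult_1)

text \<open>The type \<open>'n cproj\<close> is the complex projective space of complex dimension
  \<open>CARD('n) - 1\<close>; its points are the circle orbits in the unit sphere of \<open>complex^'n\<close>.\<close>

quotient_type 'n cproj = "complex^'n" / partial: circle_related
proof (rule part_equivpI)
  have "norm (axis undefined 1 :: complex^'n) = 1"
    by (simp add: norm_axis_1)
  then show "\<exists>p::complex^'n. circle_related p p"
    unfolding circle_related_def
    by (intro exI[of _ "axis undefined 1"] conjI exI[of _ 1]) auto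
qed (auto intro!: sympI transpI intro: circle_related_sym circle_related_trans)

text \<open>The quotient map; only its values on the unit sphere are meaningful.\<close>

definition phi :: "complex^'n \<Rightarrow> 'n cproj" where
  "phi p = abs_cproj p"

lemma phi_eq_iff:
  assumes "norm p = 1" "norm q = 1"
  shows "phi p = phi q \<longleftrightarrow> (\<exists>c::complex. norm c = 1 \<and> q = c *s p)"
proof -
  have r: "circle_related p p" "circle_related q q"
    using assms unfolding circle_related_def by (auto intro!: exI[of _ 1])
  show ?thesis
    using Quotient_rel[OF Quotient_cproj, of p q] r assms
    by (auto simp: phi_def circle_related_def)
qed

lemma phi_rep: "norm (rep_cproj x) = 1" "phi (rep_cproj x) = x"
proof -
  show "phi (rep_cproj x) = x"
    unfolding phi_def by (rule Quotient_abs_rep[OF Quotient_cproj])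
  show "norm (rep_cproj x) = 1"
    using Quotient_rep_reflp[OF Quotient_cproj, of x] by (simp add: circle_related_def)
qed


section \<open>The action of the special unitary group\<close>

definition conj_transpose :: "complex^'n^'m \<Rightarrow> complex^'m^'n" where
  "conj_transpose U = (\<chi> i j. cnj (U $ j $ i))"

definition SU :: "(complex^'n^'n) set" where
  "SU = {U. conj_transpose U ** U = mat 1 \<and> U ** conj_transpose U = mat 1 \<and> det U = 1}"

definition act :: "complex^'n^'n \<Rightarrow> 'n cproj \<Rightarrow> 'n cproj" where
  "act U x = phi (U *v rep_cproj x)"

text \<open>The Hermitian inner product, linear in the first argument. (The library's \<open>v \<bullet> w\<close>
  on \<open>complex^'n\<close> is its real part.)\<close>

definition herm :: "complex^'n \<Rightarrow> complex^'n \<Rightarrow> complex" where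
  "herm v w = (\<Sum>i\<in>UNIV. v $ i * cnj (w $ i))"

lemma herm_conj_transpose: "herm (U *v v) w = herm v (conj_transpose U *v w)"
proof -
  have "herm (U *v v) w = (\<Sum>i\<in>UNIV. \<Sum>j\<in>UNIV. U $ i $ j * v $ j * cnj (w $ i))"
    by (simp add: herm_def matrix_vector_mult_def sum_distrib_right)
  also have "\<dots> = (\<Sum>j\<in>UNIV. \<Sum>i\<in>UNIV. U $ i $ j * v $ j * cnj (w $ i))"
    by (rule sum.swap)
  also have "\<dots> = herm v (conj_transpose U *v w)"
    by (simp add: herm_def matrix_vector_mult_def conj_transpose_def sum_distrib_left mult_ac)
  finally show ?thesis .
qed

lemma herm_self: "herm v v = of_real ((norm v)\<^sup>2)"
  unfolding herm_def norm_vec_def L2_set_def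
  by (simp add: real_sqrt_pow2 sum_nonneg complex_norm_square del: of_real_power)

lemma norm_SU:
  assumes "U \<in> SU"
  shows "norm (U *v p) = norm p"
proof -
  have "herm (U *v p) (U *v p) = herm p p"
    using assms by (simp add: herm_conj_transpose matrix_vector_mul_assoc SU_def)
  then have "(norm (U *v p))\<^sup>2 = (norm p)\<^sup>2"
    by (simp only: herm_self of_real_eq_iff)
  then show ?thesis by simp
qed

lemma act_phi:
  assumes U: "U \<in> SU" and p: "norm p = 1"
  shows "act U (phi p) = phi (U *v p)"
proof -
  define q where "q = rep_cproj (phi p)"
  have q: "norm q = 1" "phi q = phi p"
    by (simp_all add: q_def phi_rep)
  then obtain c :: complex where c: "norm c = 1" "p = c *s q"
    using phi_eq_iff[of q p] p by blast
  have "U *v p = c *s (U *v q)"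
    using c by (simp add: matrix_vector_mult_def vec_eq_iff sum_distrib_left mult_ac)
  then have "phi (U *v q) = phi (U *v p)"
    using c q p norm_SU[OF U]
    by (subst phi_eq_iff) (auto simp: norm_smult_complex intro!: exI[of _ c])
  then show ?thesis by (simp add: act_def q_def)
qed


section \<open>Smooth functions\<close>

primrec Ck_on :: "nat \<Rightarrow> ('a::euclidean_space \<Rightarrow> real) \<Rightarrow> 'a set \<Rightarrow> bool" where
  "Ck_on 0 f W \<longleftrightarrow> continuous_on W f"
| "Ck_on (Suc k) f W \<longleftrightarrow>
     (\<exists>f'. (\<forall>x\<in>W. (f has_derivative f' x) (at x)) \<and> (\<forall>v. Ck_on k (\<lambda>x. f' x v) W))"

text \<open>Smoothness on an open set, and on an arbitrary subset (here: the sphere) by means of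
  local smooth extensions.\<close>

definition smooth_on_open :: "('a::euclidean_space \<Rightarrow> real) \<Rightarrow> 'a set \<Rightarrow> bool" where
  "smooth_on_open f W \<longleftrightarrow> open W \<and> (\<forall>k. Ck_on k f W)"

definition smooth_on_subset :: "('a::euclidean_space \<Rightarrow> real) \<Rightarrow> 'a set \<Rightarrow> bool" where
  "smooth_on_subset f S \<longleftrightarrow>
     (\<forall>p\<in>S. \<exists>W F. p \<in> W \<and> smooth_on_open F W \<and> (\<forall>q\<in>W \<inter> S. F q = f q))"

text \<open>The quotient map is a surjective submersion, so a function on the quotient is smooth
  if and only if its pullback to the sphere is.\<close>

definition smooth_cproj :: "('n::finite cproj \<Rightarrow> real) \<Rightarrow> bool" where
  "smooth_cproj f \<longleftrightarrow> smooth_on_subset (f \<circ> phi) (sphere 0 1)"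


section \<open>Tangent vectors and bivectors\<close>

text \<open>Tangent vectors at a point are represented by the derivations \<open>f \<mapsto> df(v)\<close> that they
  induce on smooth functions, and a bivector \<open>b\<close> by the biderivation \<open>(f, g) \<mapsto> b(df, dg)\<close>.
  Both are set to 0 on functions that are not smooth, so that equality of functionals is
  equality on smooth functions.\<close>

type_synonym 'n tvec = "('n cproj \<Rightarrow> real) \<Rightarrow> real"
type_synonym 'n bivec = "('n cproj \<Rightarrow> real) \<Rightarrow> ('n cproj \<Rightarrow> real) \<Rightarrow> real"

text \<open>The differential of \<open>phi\<close> at \<open>p\<close>, for \<open>v\<close> tangent to the sphere at \<open>p\<close>: the curve
  \<open>t \<mapsto> sgn (p + t *\<^sub>R v) = (p + t *\<^sub>R v) /\<^sub>R norm (p + t *\<^sub>R v)\<close> lies on the sphere and has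
  velocity \<open>v\<close> at \<open>t = 0\<close>.\<close>

definition Dphi :: "complex^'n \<Rightarrow> complex^'n \<Rightarrow> 'n tvec" where
  "Dphi p v =
     (\<lambda>f. if smooth_cproj f then deriv (\<lambda>t::real. f (phi (sgn (p + t *\<^sub>R v)))) 0 else 0)"

definition tangent_space :: "'n::finite cproj \<Rightarrow> 'n tvec set" where
  "tangent_space x = {Dphi p v | p v. norm p = 1 \<and> phi p = x \<and> p \<bullet> v = 0}"

definition wedge :: "'n::finite tvec \<Rightarrow> 'n tvec \<Rightarrow> 'n bivec" where
  "wedge a b = (\<lambda>f g. a f * b g - b f * a g)"

text \<open>The second exterior power of the tangent space: finite sums of decomposable bivectors.\<close>

definition bivectors_at :: "'n::finite cproj \<Rightarrow> 'n bivec set" where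
  "bivectors_at x =
     {(\<lambda>f g. \<Sum>j<m. wedge (a j) (b j) f g) | (m::nat) a b.
        \<forall>j<m. a j \<in> tangent_space x \<and> b j \<in> tangent_space x}"

text \<open>A field of bivectors is smooth if and only if it sends pairs of smooth functions to
  smooth functions.\<close>

definition bivector_field :: "('n::finite cproj \<Rightarrow> 'n bivec) \<Rightarrow> bool" where
  "bivector_field \<tau> \<longleftrightarrow>
     (\<forall>x. \<tau> x \<in> bivectors_at x) \<and>
     (\<forall>f g. smooth_cproj f \<longrightarrow> smooth_cproj g \<longrightarrow> smooth_cproj (\<lambda>x. \<tau> x f g))"

definition pushforward :: "complex^'n^'n \<Rightarrow> 'n bivec \<Rightarrow> 'n bivec" where
  "pushforward U b = (\<lambda>f g. b (f \<circ> act U) (g \<circ> act U))"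

definition SU_invariant :: "('n::finite cproj \<Rightarrow> 'n bivec) \<Rightarrow> bool" where
  "SU_invariant \<tau> \<longleftrightarrow> (\<forall>U\<in>SU. \<forall>x. pushforward U (\<tau> x) = \<tau> (act U x))"


section \<open>The canonical symplectic 2-tensor\<close>

definition E_space :: "complex^'n \<Rightarrow> (complex^'n) set" where
  "E_space p = {v. p \<bullet> v = 0 \<and> (\<i> *s p) \<bullet> v = 0}"

definition orthonormal_basis_E :: "complex^'n \<Rightarrow> (nat \<Rightarrow> complex^'n) \<Rightarrow> bool" where
  "orthonormal_basis_E p f \<longleftrightarrow>
     (\<forall>j<CARD('n) - 1. \<forall>k<CARD('n) - 1. herm (f j) (f k) = (if j = k then 1 else 0)) \<and>
     vec.span (f ` {..<CARD('n) - 1}) = E_space p"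

definition canonical_at :: "complex^'n \<Rightarrow> (nat \<Rightarrow> complex^'n) \<Rightarrow> 'n bivec" where
  "canonical_at p f =
     (\<lambda>F G. \<Sum>j<CARD('n) - 1. wedge (Dphi p (f j)) (Dphi p (\<i> *s f j)) F G)"

definition canonical_bivector :: "'n::finite cproj \<Rightarrow> 'n bivec" where
  "canonical_bivector x =
     (THE b. \<exists>p f. norm p = 1 \<and> phi p = x \<and> orthonormal_basis_E p f \<and> b = canonical_at p f)"

text \<open>Lemma \<open>canonical_bivector_phi\<close> below justifies the definite description: neither the
  representative \<open>p\<close> nor the orthonormal basis matters.\<close>

lemma herm_add_left: "herm (u + v) w = herm u w + herm v w"
  by (simp add: herm_def sum.distrib distrib_right)

lemma herm_smult_left: "herm (c *s v) w = c * herm v w"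
  by (simp add: herm_def sum_distrib_left mult_ac)

lemma herm_smult_right: "herm v (c *s w) = cnj c * herm v w"
  by (simp add: herm_def sum_distrib_left mult_ac)

lemma herm_zero_left: "herm 0 w = 0"
  by (simp add: herm_def)

lemma herm_commute: "herm v w = cnj (herm w v)"
  by (simp add: herm_def mult_ac)

lemma inner_eq_Re_herm: "p \<bullet> v = Re (herm v p)"
  by (simp add: herm_def inner_vec_def inner_complex_def mult_ac)

lemma E_space_eq: "E_space p = {v. herm v p = 0}"
  by (auto simp: E_space_def inner_eq_Re_herm herm_smult_right complex_eq_iff)

lemma orthonormal_expansion:
  fixes p :: "complex^'n"
  assumes f: "orthonormal_basis_E p f" and v: "v \<in> E_space p"
  shows "v = (\<Sum>k<CARD('n) - 1. herm v (f k) *s f k)"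
proof -
  define m where "m = CARD('n) - 1"
  define T where "T = {v. v = (\<Sum>k<m. herm v (f k) *s f k)}"
  have "vec.subspace T"
    unfolding vec.subspace_def
  proof (intro conjI ballI allI)
    show "0 \<in> T" by (simp add: T_def herm_zero_left)
  next
    fix x y assume "x \<in> T" "y \<in> T"
    then have x: "(\<Sum>k<m. herm x (f k) *s f k) = x" and y: "(\<Sum>k<m. herm y (f k) *s f k) = y"
      by (auto simp: T_def)
    have "(\<Sum>k<m. herm (x + y) (f k) *s f k)
        = (\<Sum>k<m. herm x (f k) *s f k) + (\<Sum>k<m. herm y (f k) *s f k)"
      by (simp add: herm_add_left vec.scale_left_distrib sum.distrib)
    then show "x + y \<in> T" by (simp add: T_def x y)
  next
    fix c x assume "x \<in> T"
    then have x: "(\<Sum>k<m. herm x (f k) *s f k) = x" by (simp add: T_def)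
    have "(\<Sum>k<m. herm (c *s x) (f k) *s f k) = c *s (\<Sum>k<m. herm x (f k) *s f k)"
      by (simp add: herm_smult_left vec.scale_sum_right vector_smult_assoc)
    then show "c *s x \<in> T" by (simp add: T_def x)
  qed
  moreover have "f ` {..<m} \<subseteq> T"
  proof
    fix x assume "x \<in> f ` {..<m}"
    then obtain j where j: "j < m" "x = f j" by auto
    have "(\<Sum>k<m. herm (f j) (f k) *s f k) = (\<Sum>k<m. if k = j then f j else 0)"
      using f j(1) by (intro sum.cong) (auto simp: orthonormal_basis_E_def m_def)
    also have "\<dots> = f j" using j(1) by simp
    finally show "x \<in> T" by (simp add: T_def j(2))
  qed
  ultimately have "vec.span (f ` {..<m}) \<subseteq> T"
    by (intro vec.span_minimal)
  then show ?thesis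
    using f v by (auto simp: orthonormal_basis_E_def T_def m_def)
qed

lemma sum_unitary_invariant:
  fixes A B :: "complex^'n \<Rightarrow> real" and m :: nat
  assumes A: "linear A" and B: "linear B"
    and g: "\<And>j. j < m \<Longrightarrow> g j = (\<Sum>k<m. herm (g j) (f k) *s f k)"
    and f: "\<And>k. k < m \<Longrightarrow> f k = (\<Sum>j<m. herm (f k) (g j) *s g j)"
  shows "(\<Sum>j<m. A (g j) * B (\<i> *s g j) - A (\<i> *s g j) * B (g j)) =
         (\<Sum>j<m. A (f j) * B (\<i> *s f j) - A (\<i> *s f j) * B (f j))"
proof -
  define cl where "cl L v = Complex (L v) (- L (\<i> *s v))" for L :: "complex^'n \<Rightarrow> real" and v
  have cl_smult: "cl L (c *s v) = c * cl L v" if L: "linear L" for L c v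
  proof -
    have 1: "c *s v = Re c *\<^sub>R v + Im c *\<^sub>R (\<i> *s v)"
      by (simp add: vec_eq_iff complex_eq_iff)
    have 2: "\<i> *s (c *s v) = Re c *\<^sub>R (\<i> *s v) + (- Im c) *\<^sub>R v"
      by (simp add: vec_eq_iff complex_eq_iff)
    have "L (c *s v) = Re c * L v + Im c * L (\<i> *s v)"
      unfolding 1 by (simp add: linear_add[OF L] linear_scale[OF L])
    moreover have "L (\<i> *s (c *s v)) = Re c * L (\<i> *s v) - Im c * L v"
      unfolding 2 by (simp only: linear_add[OF L] linear_scale[OF L]) simp
    ultimately show ?thesis
      by (simp add: cl_def complex_eq_iff)
  qed
  have cl_sum: "cl L (\<Sum>k<m. h k) = (\<Sum>k<m. cl L (h k))"
    if L: "linear L" for L and h :: "nat \<Rightarrow> complex^'n"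
    by (simp add: cl_def complex_eq_iff linear_sum[OF L] vec.scale_sum_right sum_negf)
  have Im_cl: "A v * B (\<i> *s v) - A (\<i> *s v) * B v = - Im (cnj (cl A v) * cl B v)" for v
    by (simp add: cl_def)
  have cl_g: "cl B (g j) = (\<Sum>k<m. herm (g j) (f k) * cl B (f k))" if "j < m" for j
    by (subst g[OF that]) (simp add: cl_sum[OF B] cl_smult[OF B])
  have cl_f: "cl A (f k) = (\<Sum>j<m. herm (f k) (g j) * cl A (g j))" if "k < m" for k
    by (subst f[OF that]) (simp add: cl_sum[OF A] cl_smult[OF A])
  have "(\<Sum>j<m. cnj (cl A (g j)) * cl B (g j))
      = (\<Sum>j<m. \<Sum>k<m. cnj (cl A (g j)) * (herm (g j) (f k) * cl B (f k)))"
    by (intro sum.cong) (simp_all add: cl_g sum_distrib_left)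
  also have "\<dots> = (\<Sum>k<m. \<Sum>j<m. cnj (cl A (g j)) * (herm (g j) (f k) * cl B (f k)))"
    by (rule sum.swap)
  also have "\<dots> = (\<Sum>k<m. cnj (cl A (f k)) * cl B (f k))"
  proof (intro sum.cong refl)
    fix k assume "k \<in> {..<m}"
    then have "cnj (cl A (f k)) = (\<Sum>j<m. herm (g j) (f k) * cnj (cl A (g j)))"
      by (simp add: cl_f herm_commute[symmetric])
    then show "(\<Sum>j<m. cnj (cl A (g j)) * (herm (g j) (f k) * cl B (f k)))
        = cnj (cl A (f k)) * cl B (f k)"
      by (simp add: sum_distrib_left mult_ac)
  qed
  finally have "(\<Sum>j<m. cnj (cl A (g j)) * cl B (g j)) = (\<Sum>k<m. cnj (cl A (f k)) * cl B (f k))" .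
  then show ?thesis
    unfolding Im_cl sum_negf Im_sum[symmetric] by simp
qed

lemma linear_Dphi:
  assumes p: "norm p = 1"
  shows "linear (\<lambda>v. Dphi p v F)"
proof (cases "smooth_cproj F")
  case False
  then show ?thesis
    by (auto simp: Dphi_def intro!: linearI)
next
  case True
  then have "smooth_on_subset (F \<circ> phi) (sphere 0 1)"
    by (simp add: smooth_cproj_def)
  then obtain W G where W: "p \<in> W" "smooth_on_open G W"
    and GF: "\<And>q. q \<in> W \<Longrightarrow> norm q = 1 \<Longrightarrow> G q = F (phi q)"
    using p unfolding smooth_on_subset_def by (auto simp: sphere_def dist_norm)
  have oW: "open W" using W by (simp add: smooth_on_open_def)
  have "Ck_on (Suc 0) G W" using W by (simp add: smooth_on_open_def)
  then obtain G' where G': "(G has_derivative G') (at p)"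
    using W(1) by auto
  have p0: "p \<noteq> 0" using p by auto
  have sgnp: "sgn p = p" using p by (simp add: sgn_div_norm)
  have "(\<lambda>q. inverse (norm q) *\<^sub>R q) differentiable (at p)"
    using p0 by (intro differentiable_scaleR differentiable_inverse differentiable_norm_at) auto
  then have "sgn differentiable (at p)"
    by (simp add: sgn_div_norm[abs_def])
  moreover have "G differentiable (at (sgn p))"
    using G' sgnp by (auto simp: differentiable_def)
  ultimately have "(G \<circ> sgn) differentiable (at p)"
    by (rule differentiable_chain_at)
  then obtain D where D: "((G \<circ> sgn) has_derivative D) (at p)"
    by (auto simp: differentiable_def)
  have op: "open (- {0} \<inter> sgn -` W :: (complex^'a) set)"
    using oW by (intro continuous_open_preimage continuous_on_sgn continuous_on_id) auto
  have H: "((\<lambda>q. F (phi (sgn q))) has_derivative D) (at p)"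
    by (rule has_derivative_transform_within_open[OF D op])
      (use p0 sgnp W(1) in \<open>auto intro!: GF simp: norm_sgn\<close>)
  have "Dphi p v F = D v" for v
  proof -
    have 1: "((\<lambda>t::real. p + t *\<^sub>R v) has_derivative (\<lambda>t. t *\<^sub>R v)) (at 0)"
      by (auto intro!: derivative_eq_intros)
    have "((\<lambda>t::real. F (phi (sgn (p + t *\<^sub>R v)))) has_derivative (\<lambda>t. D (t *\<^sub>R v))) (at 0)"
      using has_derivative_compose[OF 1, of "\<lambda>q. F (phi (sgn q))" D] H by simp
    then have "((\<lambda>t::real. F (phi (sgn (p + t *\<^sub>R v)))) has_field_derivative D v) (at 0)"
      using has_derivative_linear[OF D]
      by (simp add: has_field_derivative_def linear_scale mult_commute_abs)
    then show ?thesis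
      using True by (simp add: Dphi_def DERIV_imp_deriv)
  qed
  then show ?thesis
    using has_derivative_linear[OF D] by (simp cong: arg_cong[where f = linear])
qed

lemma Dphi_rotate:
  assumes c: "norm (c::complex) = 1"
  shows "Dphi (c *s p) (c *s v) = Dphi p v"
proof -
  have "phi (sgn (c *s p + t *\<^sub>R (c *s v))) = phi (sgn (p + t *\<^sub>R v))" for t :: real
  proof -
    define u where "u = p + t *\<^sub>R v"
    have e: "c *s p + t *\<^sub>R (c *s v) = c *s u"
      by (simp add: u_def vec_eq_iff algebra_simps)
    have s: "sgn (c *s u) = c *s sgn u"
      using c by (simp add: sgn_div_norm norm_smult_complex vec_eq_iff)
    show ?thesis
    proof (cases "u = 0")
      case True
      then show ?thesis unfolding e by (simp add: u_def)
    next
      case False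
      then have "norm (sgn u) = 1" by (simp add: norm_sgn)
      then have "phi (sgn u) = phi (c *s sgn u)"
        using c by (subst phi_eq_iff) (auto simp: norm_smult_complex)
      then show ?thesis unfolding e s by (simp add: u_def)
    qed
  qed
  then show ?thesis by (simp add: Dphi_def cong: if_cong)
qed

lemma canonical_at_unique:
  fixes p q :: "complex^'n"
  assumes p: "norm p = 1" and q: "norm q = 1" and pq: "phi p = phi q"
    and f: "orthonormal_basis_E p f" and g: "orthonormal_basis_E q g"
  shows "canonical_at p f = canonical_at q g"
proof -
  obtain c :: complex where c: "norm c = 1" "q = c *s p"
    using pq p q phi_eq_iff by blast
  define d where "d = cnj c"
  have cd: "c * d = 1" "d * c = 1"
    using c(1) by (simp_all add: d_def complex_norm_square[symmetric] mult.commute[of "cnj c"])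
  have d: "norm d = 1" "p = d *s q"
    using c cd by (simp_all add: d_def vector_smult_assoc)
  define g' where "g' j = d *s g j" for j
  have fE: "f j \<in> E_space p" if "j < CARD('n) - 1" for j
    using f that vec.span_superset[of "f ` {..<CARD('n) - 1}"]
    by (auto simp: orthonormal_basis_E_def)
  have gE: "g j \<in> E_space q" if "j < CARD('n) - 1" for j
    using g that vec.span_superset[of "g ` {..<CARD('n) - 1}"]
    by (auto simp: orthonormal_basis_E_def)
  have g'E: "g' j \<in> E_space p" if "j < CARD('n) - 1" for j
    using gE[OF that] by (simp add: E_space_eq g'_def d(2) herm_smult_left herm_smult_right)
  have exp_g: "g' j = (\<Sum>k<CARD('n) - 1. herm (g' j) (f k) *s f k)" if "j < CARD('n) - 1" for j
    by (rule orthonormal_expansion[OF f g'E[OF that]])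
  have exp_f: "f k = (\<Sum>j<CARD('n) - 1. herm (f k) (g' j) *s g' j)" if "k < CARD('n) - 1" for k
  proof -
    have "c *s f k \<in> E_space q"
      using fE[OF that] by (simp add: E_space_eq c(2) herm_smult_left herm_smult_right)
    then have "c *s f k = (\<Sum>j<CARD('n) - 1. herm (c *s f k) (g j) *s g j)"
      by (rule orthonormal_expansion[OF g])
    then have "d *s (c *s f k) = (\<Sum>j<CARD('n) - 1. herm (f k) (g' j) *s g' j)"
      by (simp add: vec.scale_sum_right vector_smult_assoc g'_def herm_smult_left
          herm_smult_right d_def mult_ac)
    then show ?thesis
      using cd by (simp add: vector_smult_assoc)
  qed
  have rot: "Dphi p (g' j) = Dphi q (g j)" "Dphi p (\<i> *s g' j) = Dphi q (\<i> *s g j)" for j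
    using Dphi_rotate[OF d(1), of q "g j"] Dphi_rotate[OF d(1), of q "\<i> *s g j"]
    by (simp_all add: d(2)[symmetric] g'_def vector_smult_assoc mult.commute)
  show ?thesis
  proof (intro ext)
    fix F G
    show "canonical_at p f F G = canonical_at q g F G"
      using sum_unitary_invariant[OF linear_Dphi[OF p, of F] linear_Dphi[OF p, of G] exp_g exp_f]
      by (simp add: canonical_at_def wedge_def rot)
  qed
qed

lemma canonical_bivector_phi:
  assumes "norm p = 1" "orthonormal_basis_E p f"
  shows "canonical_bivector (phi p) = canonical_at p f"
  unfolding canonical_bivector_def
  using assms by (intro the_equality) (auto intro: canonical_at_unique)

end

theory Submission
  imports Defs
begin

text \<open>In terms of the gradients of \<open>F\<close> and \<open>G\<close> at \<open>p\<close>, vectors in \<open>E_space p\<close>, a bivector at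
  \<open>phi p\<close> is a skew real-bilinear form \<open>\<Omega>\<close>. The quadratic functions \<open>Re (herm q p * cnj (herm q w))\<close>
  have every gradient \<open>w \<in> E_space p\<close>, and unitary matrices permute them, so the form of an
  invariant field is invariant under the unitary stabilizer of \<open>p\<close> (scalar matrices act trivially,
  hence the determinant does not matter). By the complex reflection in a basis vector \<open>f j\<close>,
  \<open>\<Omega>\<close> vanishes between \<open>f j\<close> and its complex orthogonal complement, and a reflection exchanging
  \<open>f 0\<close> and \<open>f j\<close> equates \<open>\<Omega> (f j) (\<i> f j)\<close> with \<open>\<Omega> (f 0) (\<i> f 0)\<close>; so \<open>\<Omega>\<close> is a multiple of the symplectic form.
  The factor does not depend on the point, because reflections act transitively.\<close>

section \<open>Unitary matrices and reflections\<close>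

text \<open>No determinant condition is imposed: reflections in unit vectors have determinant -1.
  \<open>unitary_scale_SU\<close> returns to \<open>SU\<close> at the cost of a phase.\<close>

definition unitary :: "complex^'n^'n \<Rightarrow> bool" where
  "unitary U \<longleftrightarrow> conj_transpose U ** U = mat 1 \<and> U ** conj_transpose U = mat 1"

text \<open>For a unit vector \<open>w\<close> this negates \<open>w\<close> and fixes its Hermitian
  complement; for \<open>w = 0\<close> it is the identity, which covers the degenerate case
  \<open>sgn 0\<close>.\<close>

definition reflection :: "complex^'n \<Rightarrow> complex^'n^'n" where
  "reflection w = (\<chi> i j. (if i = j then 1 else 0) - 2 * w $ i * cnj (w $ j))"

lemma herm_diff_left: "herm (u - v) w = herm u w - herm v w"
  by (simp add: herm_def sum_subtractf left_diff_distrib)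

lemma herm_diff_right: "herm v (u - w) = herm v u - herm v w"
  by (simp add: herm_def sum_subtractf right_diff_distrib)

lemma scaleR_eq_smult: "r *\<^sub>R (v :: complex^'n) = complex_of_real r *s v"
  by (simp add: vec_eq_iff complex_eq_iff)

lemma herm_scaleR_left: "herm (r *\<^sub>R v) w = of_real r * herm v w"
  by (simp add: scaleR_eq_smult herm_smult_left)

lemma herm_scaleR_right: "herm v (r *\<^sub>R w) = of_real r * herm v w"
  by (simp add: scaleR_eq_smult herm_smult_right)

lemma reflection_mult_vec: "reflection w *v x = x - (2 * herm x w) *s w"
proof -
  have "(\<Sum>j\<in>UNIV. ((if i = j then 1 else 0) - 2 * w $ i * cnj (w $ j)) * x $ j)
      = x $ i - 2 * herm x w * w $ i" for i
  proof -
    have "(\<Sum>j\<in>UNIV. ((if i = j then 1 else 0) - 2 * w $ i * cnj (w $ j)) * x $ j)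
      = (\<Sum>j\<in>UNIV. (if i = j then x $ j else 0) - 2 * w $ i * (x $ j * cnj (w $ j)))"
      by (intro sum.cong) (auto simp: algebra_simps)
    also have "\<dots> = x $ i - 2 * w $ i * herm x w"
      by (simp add: sum_subtractf herm_def sum_distrib_left)
    finally show ?thesis by (simp add: mult_ac)
  qed
  then show ?thesis
    by (simp add: vec_eq_iff reflection_def matrix_vector_mult_def)
qed

lemma conj_transpose_reflection: "conj_transpose (reflection w) = reflection w"
  by (auto simp: conj_transpose_def reflection_def vec_eq_iff)

lemma unitary_reflection:
  assumes "norm w = 1 \<or> w = 0"
  shows "unitary (reflection w)"
proof -
  \<comment> \<open>The matrix equals its conjugate transpose, so unitarity amounts to being an
    involution.\<close>
  have "reflection w *v (reflection w *v x) = x" for x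
    using assms
    by (auto simp: reflection_mult_vec herm_diff_left herm_smult_left herm_self vec_eq_iff
        algebra_simps)
  then have "reflection w ** reflection w = mat 1"
    by (simp add: matrix_eq matrix_vector_mul_assoc[symmetric])
  then show ?thesis
    by (simp add: unitary_def conj_transpose_reflection)
qed

lemma norm_sgn_cases: "norm (sgn (w :: 'a::real_normed_vector)) = 1 \<or> sgn w = 0"
  by (simp add: norm_sgn)

text \<open>When \<open>herm p q\<close> is real, \<open>p + q\<close> is Hermitian orthogonal to
  \<open>p - q\<close>, so the reflection fixes the sum and negates the difference. In the
  computation, \<open>2 * herm p (p - q)\<close> equals the squared norm of
  \<open>p - q\<close>.\<close>

lemma reflection_swap:
  fixes p q :: "complex^'n"
  assumes p: "norm p = 1" and q: "norm q = 1" and real: "Im (herm p q) = 0"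
  shows "reflection (sgn (p - q)) *v p = q"
proof (cases "p = q")
  case True
  then show ?thesis by (simp add: reflection_mult_vec)
next
  case False
  define N where "N = norm (p - q)"
  have N: "N \<noteq> 0" using False by (simp add: N_def)
  have pq: "herm q p = herm p q"
    using real by (subst herm_commute) (simp add: complex_eq_iff)
  have "of_real (N\<^sup>2) = herm (p - q) (p - q)"
    by (simp add: N_def herm_self)
  also have "\<dots> = 2 * herm p (p - q)"
    unfolding herm_diff_left herm_diff_right pq using p q by (simp add: herm_self)
  finally have "2 * herm p (p - q) = of_real N * of_real N"
    by (simp add: power2_eq_square)
  then have "2 * herm p (sgn (p - q)) = of_real N"
    using N unfolding sgn_div_norm herm_scaleR_right N_def[symmetric] by (simp add: field_simps)
  then show ?thesis
    using N by (simp add: reflection_mult_vec sgn_div_norm N_def[symmetric] vec_eq_iff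
        scaleR_eq_smult)
qed

lemma herm_unitary:
  assumes "unitary U"
  shows "herm (U *v v) (U *v w) = herm v w"
  using assms by (simp add: herm_conj_transpose matrix_vector_mul_assoc unitary_def)

lemma norm_unitary:
  assumes "unitary U"
  shows "norm (U *v v) = norm v"
proof -
  have "(norm (U *v v))\<^sup>2 = (norm v)\<^sup>2"
    using herm_unitary[OF assms, of v v] by (simp only: herm_self of_real_eq_iff)
  then show ?thesis by simp
qed

section \<open>Rescaling unitary matrices to determinant one\<close>

lemma det_conj_transpose: "det (conj_transpose U) = cnj (det (U :: complex^'n^'n))"
proof -
  have "cnj (det U) = det (\<chi> i j. cnj (U $ i $ j))"
    by (simp add: det_def cnj_sum cnj_prod)
  also have "\<dots> = det (transpose (\<chi> i j. cnj (U $ i $ j)))"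
    by (simp only: det_transpose)
  also have "transpose (\<chi> i j. cnj (U $ i $ j)) = conj_transpose U"
    by (simp add: transpose_def conj_transpose_def vec_eq_iff)
  finally show ?thesis by simp
qed

lemma unit_complex_root:
  fixes z :: complex
  assumes "norm z = 1" "0 < n"
  obtains c where "norm c = 1" "c ^ n = z"
proof
  show "norm (cis (Arg z / n)) = 1" by simp
  have "cis (Arg z / n) ^ n = cis (real n * (Arg z / n))"
    by (rule Complex.DeMoivre)
  also have "\<dots> = cis (Arg z)"
    using assms(2) by simp
  also have "\<dots> = z"
    using assms(1) cis_Arg[of z] by (cases "z = 0") (simp_all add: sgn_div_norm)
  finally show "cis (Arg z / n) ^ n = z" .
qed

text \<open>The determinant of \<open>U\<close> has modulus 1, so its inverse has a root
  \<open>c\<close> of order \<open>CARD('n)\<close> on the unit circle, and \<open>c\<close> times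
  \<open>U\<close> has determinant 1.\<close>

lemma unitary_scale_SU:
  fixes U :: "complex^'n^'n"
  assumes U: "unitary U"
  obtains c V where "norm c = 1" "V \<in> SU" "\<And>x. V *v x = c *s (U *v x)"
proof -
  have "cnj (det U) * det U = 1"
    using U det_mul[of "conj_transpose U" U] by (simp add: unitary_def det_conj_transpose)
  then have "norm (cnj (det U) * det U) = 1" by simp
  then have "(norm (det U))\<^sup>2 = 1" by (simp add: norm_mult power2_eq_square)
  then have "norm (det U) = 1" by (simp add: power2_eq_1_iff) (use norm_ge_zero[of "det U"] in linarith)
  then obtain c where c: "norm c = 1" "c ^ CARD('n) = inverse (det U)"
    using unit_complex_root[of "inverse (det U)" "CARD('n)"] by (auto simp: norm_inverse)
  define V where "V = mat c ** U"
  have entries: "V $ i $ j = c * U $ i $ j" for i j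
    by (simp add: V_def matrix_matrix_mult_def mat_def if_distrib[of "\<lambda>a. a * _"] cong: if_cong)
  have V: "V *v x = c *s (U *v x)" for x
    by (simp add: entries matrix_vector_mult_def vec_eq_iff sum_distrib_left mult_ac)
  have V': "conj_transpose V *v x = cnj c *s (conj_transpose U *v x)" for x
    by (simp add: entries conj_transpose_def matrix_vector_mult_def vec_eq_iff sum_distrib_left
        mult_ac)
  have cc: "c * cnj c = 1"
    using c(1) by (simp add: complex_norm_square[symmetric])
  have "det V = c ^ CARD('n) * det U"
  proof -
    have "det (mat c :: complex^'n^'n) = c ^ CARD('n)"
      by (subst det_diagonal) (auto simp: mat_def)
    then show ?thesis by (simp add: V_def det_mul)
  qed
  then have "det V = 1"
    using c(2) \<open>norm (det U) = 1\<close> left_inverse[of "det U"] by fastforce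
  moreover have "conj_transpose V ** V = mat 1" "V ** conj_transpose V = mat 1"
    using U cc
    by (simp_all add: matrix_eq matrix_vector_mul_assoc[symmetric] V V' unitary_def
        vec.linear_scale[OF matrix_vector_mul_linear_gen] vector_smult_assoc mult.commute)
  ultimately show thesis
    using that[of c V] c(1) V by (simp add: SU_def)
qed


lemma phi_smult:
  assumes "norm c = 1" "norm p = 1"
  shows "phi (c *s p) = phi p"
proof -
  have "phi p = phi (c *s p)"
    by (subst phi_eq_iff) (use assms in \<open>auto simp: norm_smult_complex\<close>)
  then show ?thesis by simp
qed


section \<open>Test functions with prescribed gradient\<close>

text \<open>A change of phase of the representative cancels between the two factors, so the choice
  made by \<open>rep_cproj\<close> does not matter.\<close>

definition herm_fun :: "complex^'n \<Rightarrow> complex^'n \<Rightarrow> 'n cproj \<Rightarrow> real" where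
  "herm_fun a b x = Re (herm (rep_cproj x) a * cnj (herm (rep_cproj x) b))"

lemma herm_fun_phi:
  assumes "norm q = 1"
  shows "herm_fun a b (phi q) = Re (herm q a * cnj (herm q b))"
proof -
  obtain c where c: "norm (c::complex) = 1" "q = c *s rep_cproj (phi q)"
    using phi_eq_iff[of "rep_cproj (phi q)" q] assms by (auto simp: phi_rep)
  have "c * cnj c = 1"
    using c(1) by (simp add: complex_norm_square[symmetric])
  moreover have "herm q u = c * herm (rep_cproj (phi q)) u" for u
    by (subst c(2)) (rule herm_smult_left)
  ultimately have "herm q a * cnj (herm q b) =
      herm (rep_cproj (phi q)) a * cnj (herm (rep_cproj (phi q)) b)"
    by (simp add: mult_ac flip: mult.assoc[of c "cnj c"])
  then show ?thesis by (simp add: herm_fun_def)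
qed

lemma Ck_on_const: "Ck_on k (\<lambda>x. c) W"
  by (induction k arbitrary: c) (auto intro!: exI[of _ "\<lambda>x v. 0"])

lemma Ck_on_bounded_linear:
  assumes "bounded_linear L"
  shows "Ck_on k L W"
proof (cases k)
  case 0
  then show ?thesis
    using assms by (simp add: linear_continuous_on)
next
  case (Suc k)
  then show ?thesis
    using assms by (auto intro!: exI[of _ "\<lambda>x. L"] Ck_on_const bounded_linear_imp_has_derivative)
qed

text \<open>One differentiation leaves a function linear in \<open>x\<close>, to which
  \<open>Ck_on_bounded_linear\<close> applies at every order.\<close>

lemma Ck_on_quadratic:
  assumes B: "bounded_bilinear B"
  shows "Ck_on k (\<lambda>x. B x x) W"
proof (cases k)
  case 0
  then show ?thesis
    by (auto intro!: bounded_bilinear.continuous_on[OF B] continuous_on_id)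
next
  case (Suc k)
  have "((\<lambda>x. B x x) has_derivative (\<lambda>v. B x v + B v x)) (at x)" for x
    using bounded_bilinear.FDERIV[OF B has_derivative_ident has_derivative_ident] by simp
  moreover have "Ck_on k (\<lambda>x. B x v + B v x) W" for v
    by (intro Ck_on_bounded_linear bounded_linear_add bounded_bilinear.bounded_linear_left[OF B]
        bounded_bilinear.bounded_linear_right[OF B])
  ultimately show ?thesis
    using Suc by (auto intro!: exI[of _ "\<lambda>x v. B x v + B v x"])
qed

text \<open>The pullback to the sphere is the restriction of a real quadratic form, which serves as
  a global smooth extension.\<close>

lemma smooth_herm_fun: "smooth_cproj (herm_fun a b)"
proof -
  define B where "B x y = Re (herm x a * cnj (herm y b))" for x y :: "complex^'a"
  have "bilinear B"
    unfolding bilinear_def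
    by (intro conjI allI linearI)
      (simp_all add: B_def herm_add_left herm_scaleR_left algebra_simps)
  then have "\<forall>k. Ck_on k (\<lambda>x. B x x) UNIV"
    by (simp add: Ck_on_quadratic bilinear_conv_bounded_bilinear)
  then show ?thesis
    unfolding smooth_cproj_def smooth_on_subset_def smooth_on_open_def
    by (intro ballI exI[of _ UNIV] exI[of _ "\<lambda>x. B x x"]) (simp add: herm_fun_phi B_def)
qed

text \<open>The adjoint at 1 is the Riesz vector of the functional
  \<open>v \<mapsto> Dphi p v F\<close> on the whole ambient space; it is 0 for non-smooth
  \<open>F\<close>.\<close>

definition grad :: "complex^'n \<Rightarrow> ('n cproj \<Rightarrow> real) \<Rightarrow> complex^'n" where
  "grad p F = adjoint (\<lambda>v. Dphi p v F) 1"

lemma Dphi_eq_inner_grad: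
  assumes "norm p = 1"
  shows "Dphi p v F = v \<bullet> grad p F"
  using adjoint_works[OF linear_Dphi[OF assms, of F], of v 1] by (simp add: grad_def)

text \<open>Near \<open>t = 0\<close> the normalized curve stays in the circle orbit of
  \<open>p\<close>. Taking \<open>a = 1\<close> gives the radial direction and
  \<open>a = \<i>\<close> the orbit direction, the two that \<open>E_space p\<close>
  excludes.\<close>

lemma Dphi_vertical:
  assumes p: "norm p = 1"
  shows "Dphi p (a *s p) F = 0"
proof -
  \<comment> \<open>Where the scalar vanishes, \<open>sgn\<close> leaves the sphere; the derivative
    at 0 sees only small \<open>t\<close>, where this does not happen.\<close>
  have ev: "eventually (\<lambda>t::real. 1 + of_real t * a \<noteq> 0) (nhds 0)"
  proof -
    have "((\<lambda>t::real. 1 + of_real t * a) \<longlongrightarrow> 1 + of_real 0 * a) (nhds 0)"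
      by (intro tendsto_intros filterlim_ident)
    then show ?thesis
      by (rule tendsto_imp_eventually_ne) simp
  qed
  have "F (phi (sgn (p + t *\<^sub>R (a *s p)))) = F (phi p)" if "1 + of_real t * a \<noteq> 0" for t :: real
  proof -
    define z where "z = 1 + of_real t * a"
    have "p + t *\<^sub>R (a *s p) = z *s p"
      by (simp add: z_def vec_eq_iff algebra_simps scaleR_eq_smult)
    moreover have "sgn (z *s p) = sgn z *s p"
      using p by (simp add: sgn_div_norm norm_smult_complex vec_eq_iff)
    moreover have "norm (sgn z) = 1"
      using that by (simp add: z_def norm_sgn)
    ultimately show ?thesis
      by (simp add: phi_smult p)
  qed
  then have "eventually (\<lambda>t. F (phi (sgn (p + t *\<^sub>R (a *s p)))) = F (phi p)) (nhds 0)"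
    by (intro eventually_mono[OF ev])
  then have "deriv (\<lambda>t. F (phi (sgn (p + t *\<^sub>R (a *s p))))) 0 = deriv (\<lambda>t::real. F (phi p)) 0"
    by (intro deriv_cong_ev refl)
  then show ?thesis by (simp add: Dphi_def)
qed

lemma grad_in_E_space:
  assumes p: "norm p = 1"
  shows "grad p F \<in> E_space p"
  using Dphi_vertical[OF p, of 1 F] Dphi_vertical[OF p, of \<i> F]
  by (simp add: E_space_def Dphi_eq_inner_grad[OF p])

text \<open>At \<open>u = p + t *\<^sub>R v\<close> the Hermitian products with \<open>p\<close> and
  \<open>w\<close> are \<open>1 + t \<alpha>\<close> and \<open>t \<beta>\<close>, because
  \<open>herm p w = 0\<close>. After division by the squared norm of \<open>u\<close>, the
  first-order coefficient is \<open>Re \<beta> = v \<bullet> w\<close>.\<close>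

lemma grad_herm_fun:
  assumes p: "norm p = 1" and w: "w \<in> E_space p"
  shows "grad p (herm_fun p w) = w"
proof -
  have pw: "herm p w = 0"
    using w by (subst herm_commute) (simp add: E_space_eq)
  have "Dphi p v (herm_fun p w) = v \<bullet> w" for v
  proof -
    define \<alpha> \<beta> where "\<alpha> = herm v p" and "\<beta> = herm v w"
    define n where "n t = (p + t *\<^sub>R v) \<bullet> (p + t *\<^sub>R v)" for t :: real
    have p0: "p \<noteq> 0" using p by auto
    have ev: "eventually (\<lambda>t::real. p + t *\<^sub>R v \<noteq> 0) (nhds 0)"
    proof -
      have "((\<lambda>t::real. p + t *\<^sub>R v) \<longlongrightarrow> p + 0 *\<^sub>R v) (nhds 0)"
        by (intro tendsto_intros filterlim_ident)
      then show ?thesis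
        by (rule tendsto_imp_eventually_ne) (use p0 in simp)
    qed
    have eq: "herm_fun p w (phi (sgn (p + t *\<^sub>R v))) =
        t * (Re \<beta> + t * Re (\<alpha> * cnj \<beta>)) / n t" if "p + t *\<^sub>R v \<noteq> 0" for t :: real
    proof -
      define u where "u = p + t *\<^sub>R v"
      have u: "norm (sgn u) = 1" using that by (simp add: u_def norm_sgn)
      have "herm u p = 1 + of_real t * \<alpha>" "herm u w = of_real t * \<beta>"
        using p by (simp_all add: u_def herm_add_left herm_scaleR_left herm_self pw \<alpha>_def \<beta>_def)
      then show ?thesis
        unfolding u_def[symmetric] n_def herm_fun_phi[OF u]
        by (simp add: sgn_div_norm herm_scaleR_left dot_square_norm power2_eq_square field_simps)
    qed
    have "((\<lambda>t. t * (Re \<beta> + t * Re (\<alpha> * cnj \<beta>)) / n t) has_field_derivative Re \<beta>) (at 0)"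
    proof -
      have n0: "n 0 = 1" using p by (simp add: n_def dot_square_norm)
      have "(n has_field_derivative 2 * (p \<bullet> v)) (at 0)"
        unfolding n_def
        by (auto intro!: derivative_eq_intros simp: has_field_derivative_def inner_commute algebra_simps fun_eq_iff)
      then show ?thesis
        by (auto intro!: derivative_eq_intros simp: n0)
    qed
    moreover have "deriv (\<lambda>t. herm_fun p w (phi (sgn (p + t *\<^sub>R v)))) 0 =
        deriv (\<lambda>t. t * (Re \<beta> + t * Re (\<alpha> * cnj \<beta>)) / n t) 0"
      by (intro deriv_cong_ev refl eventually_mono[OF ev] eq)
    ultimately show ?thesis
      by (simp add: Dphi_def smooth_herm_fun DERIV_imp_deriv \<beta>_def inner_commute[of v w]
          inner_eq_Re_herm[of w v])
  qed
  then have "v \<bullet> grad p (herm_fun p w) = v \<bullet> w" for v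
    by (simp add: Dphi_eq_inner_grad[OF p])
  then show ?thesis
    by (rule vector_eq_ldot[THEN iffD1, rule_format])
qed

section \<open>Bivectors at a point as skew real-bilinear forms\<close>

lemma bivector_bilinear_form:
  assumes p: "norm p = 1" and b: "b \<in> bivectors_at (phi p)"
  obtains \<Omega> where "bilinear \<Omega>" "\<And>v w. \<Omega> v w = - \<Omega> w v" "\<And>F G. b F G = \<Omega> (grad p F) (grad p G)"
proof -
  obtain m :: nat and a a' where b_eq: "b = (\<lambda>F G. \<Sum>j<m. wedge (a j) (a' j) F G)"
    and a: "\<forall>j<m. a j \<in> tangent_space (phi p) \<and> a' j \<in> tangent_space (phi p)"
    using b unfolding bivectors_at_def by blast
  \<comment> \<open>A tangent vector may be given at another point of the fibre; a rotation brings
    it to \<open>p\<close>.\<close>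
  have tangent: "\<exists>v. t = Dphi p v" if "t \<in> tangent_space (phi p)" for t
  proof -
    obtain q u where t: "t = Dphi q u" "norm q = 1" "phi q = phi p"
      using \<open>t \<in> tangent_space (phi p)\<close> unfolding tangent_space_def by blast
    then obtain c where "norm c = 1" "p = c *s q"
      using phi_eq_iff[of q p] p by blast
    then show ?thesis
      using Dphi_rotate[of c q u] t(1) by metis
  qed
  have "\<forall>j. \<exists>v w. j < m \<longrightarrow> a j = Dphi p v \<and> a' j = Dphi p w"
    using a tangent by blast
  then obtain v w where v: "\<And>j. j < m \<Longrightarrow> a j = Dphi p (v j)"
    and w: "\<And>j. j < m \<Longrightarrow> a' j = Dphi p (w j)"
    unfolding choice_iff by blast
  \<comment> \<open>Each wedge is contracted with the two gradients, which replace the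
    functions.\<close>
  define \<Omega> where "\<Omega> x y = (\<Sum>j<m. (v j \<bullet> x) * (w j \<bullet> y) - (w j \<bullet> x) * (v j \<bullet> y))" for x y
  show thesis
  proof (rule that)
    show "bilinear \<Omega>"
      unfolding bilinear_def
      by (intro conjI allI linearI)
        (simp_all add: \<Omega>_def inner_add_right sum_distrib_left algebra_simps sum.distrib
          sum_subtractf)
    show "\<Omega> x y = - \<Omega> y x" for x y
      by (simp add: \<Omega>_def flip: sum_negf) (simp add: mult.commute)
    show "b F G = \<Omega> (grad p F) (grad p G)" for F G
      by (simp add: b_eq \<Omega>_def wedge_def v w Dphi_eq_inner_grad[OF p])
  qed
qed


section \<open>Isotropy and transitivity\<close>

text \<open>The phase between \<open>U\<close> and its rescaling \<open>V\<close> disappears both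
  from the point and from the test functions, so invariance extends from \<open>SU\<close> to all
  unitary matrices.\<close>

lemma SU_invariant_herm_fun:
  assumes inv: "SU_invariant \<tau>" and U: "unitary U" and p: "norm p = 1"
  shows "\<tau> (phi (U *v p)) (herm_fun (U *v a) (U *v b)) (herm_fun (U *v a') (U *v b')) =
         \<tau> (phi p) (herm_fun a b) (herm_fun a' b')"
proof -
  obtain c V where c: "norm c = 1" and V: "V \<in> SU" "\<And>x. V *v x = c *s (U *v x)"
    using unitary_scale_SU[OF U] by metis
  have cc: "c * cnj c = 1"
    using c by (simp add: complex_norm_square[symmetric])
  have "act V (phi p) = phi (U *v p)"
    by (simp add: act_phi[OF V(1) p] V(2) phi_smult c norm_unitary[OF U] p)
  moreover have "herm_fun (U *v a) (U *v b) \<circ> act V = herm_fun a b" for a b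
  proof
    fix x
    have "herm_fun (U *v a) (U *v b) (act V x) =
        Re ((c * cnj c) * (herm (rep_cproj x) a * cnj (herm (rep_cproj x) b)))"
      using norm_SU[OF V(1), of "rep_cproj x"]
      by (simp add: act_def herm_fun_phi phi_rep V(2) herm_smult_left herm_unitary[OF U] mult_ac)
    then show "(herm_fun (U *v a) (U *v b) \<circ> act V) x = herm_fun a b x"
      by (simp add: cc herm_fun_def)
  qed
  moreover have "pushforward V (\<tau> (phi p)) = \<tau> (act V (phi p))"
    using inv V(1) by (simp add: SU_invariant_def)
  ultimately show ?thesis
    by (metis pushforward_def)
qed

lemma transitive_unitary:
  fixes x :: "'n::finite cproj"
  assumes p: "norm p = 1"
  obtains U where "unitary U" "phi (U *v p) = x"
proof -
  define q where "q = rep_cproj x"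
  \<comment> \<open>This phase turns \<open>herm p (c *s q)\<close> into the modulus of
    \<open>herm p q\<close>, as \<open>reflection_swap\<close> requires a real product. The value 1
    replaces \<open>sgn 0\<close>, which is not a phase.\<close>
  define c where "c = (if herm p q = 0 then 1 else sgn (herm p q))"
  have q: "norm q = 1" "phi q = x" by (simp_all add: q_def phi_rep)
  have c: "norm c = 1" by (simp add: c_def norm_sgn)
  have "Im (herm p (c *s q)) = 0"
    by (simp add: herm_smult_right c_def sgn_div_norm)
  then have "reflection (sgn (p - c *s q)) *v p = c *s q"
    using p c q by (intro reflection_swap) (auto simp: norm_smult_complex)
  moreover have "phi (c *s q) = x"
    by (simp add: phi_smult c q)
  ultimately show thesis
    using that[OF unitary_reflection[OF norm_sgn_cases]] by metis
qed

section \<open>Orthonormal bases at a coordinate axis and their transport\<close>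

lemma orthonormal_basis_E_axis:
  "\<exists>f. orthonormal_basis_E (axis k 1 :: complex^'n) f"
proof -
  have "card (UNIV - {k}) = CARD('n) - 1"
    by (simp add: card_Diff_subset)
  \<comment> \<open>\<open>g\<close> enumerates the coordinates other than \<open>k\<close>; their
    axes form the basis.\<close>
  then obtain g where g: "bij_betw g {..<CARD('n) - 1} (UNIV - {k})"
    using ex_bij_betw_nat_finite[of "UNIV - {k}"] by (auto simp: atLeast0LessThan)
  have g_k: "g j \<noteq> k" if "j < CARD('n) - 1" for j
    using bij_betwE[OF g] that by auto
  define f where "f j = (axis (g j) 1 :: complex^'n)" for j
  have herm_axis: "herm v (axis i 1) = v $ i" for v :: "complex^'n" and i
    by (simp add: herm_def axis_def if_distrib[of cnj] if_distrib[of "\<lambda>a. _ * a"] cong: if_cong)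
  have "herm (f j) (f l) = (if j = l then 1 else 0)"
    if "j < CARD('n) - 1" "l < CARD('n) - 1" for j l
  proof -
    have "herm (f j) (f l) = axis (g j) 1 $ g l"
      by (simp only: f_def herm_axis)
    then show ?thesis
      using bij_betw_imp_inj_on[OF g] that by (auto simp: axis_def inj_on_def)
  qed
  moreover have "vec.span (f ` {..<CARD('n) - 1}) = E_space (axis k 1)"
  proof
    have "vec.subspace (E_space (axis k 1 :: complex^'n))"
      by (auto simp: vec.subspace_def E_space_eq herm_axis)
    moreover have "f ` {..<CARD('n) - 1} \<subseteq> E_space (axis k 1)"
      using g_k by (auto simp: E_space_eq herm_axis f_def) (auto simp: axis_def)
    ultimately show "vec.span (f ` {..<CARD('n) - 1}) \<subseteq> E_space (axis k 1)"
      by (intro vec.span_minimal)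
  next
    show "E_space (axis k 1) \<subseteq> vec.span (f ` {..<CARD('n) - 1})"
    proof
      fix v :: "complex^'n" assume "v \<in> E_space (axis k 1)"
      then have vk: "v $ k = 0" by (simp add: E_space_eq herm_axis)
      have "v $ i *s axis i 1 \<in> vec.span (f ` {..<CARD('n) - 1})" for i
      proof (cases "i = k")
        case True
        then show ?thesis by (simp add: vk vec.span_zero)
      next
        case False
        then have "i \<in> g ` {..<CARD('n) - 1}"
          unfolding bij_betw_imp_surj_on[OF g] by simp
        then obtain j where "j < CARD('n) - 1" "g j = i"
          by auto
        then show ?thesis
          by (intro vec.span_scale vec.span_base) (auto simp: f_def)
      qed
      then have "(\<Sum>i\<in>UNIV. v $ i *s axis i 1) \<in> vec.span (f ` {..<CARD('n) - 1})"
        by (intro vec.span_sum)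
      then show "v \<in> vec.span (f ` {..<CARD('n) - 1})"
        by (simp add: basis_expansion)
    qed
  qed
  ultimately show ?thesis
    unfolding orthonormal_basis_E_def by blast
qed

text \<open>\<open>U\<close> preserves Hermitian products and carries \<open>E_space p\<close> onto
  \<open>E_space (U *v p)\<close>, with preimages supplied by \<open>conj_transpose U\<close>. One
  basis thereby yields a basis at every point of the orbit.\<close>

lemma orthonormal_basis_E_unitary:
  assumes f: "orthonormal_basis_E p f" and U: "unitary U"
  shows "orthonormal_basis_E (U *v p) (\<lambda>j. U *v f j)"
proof -
  have "(*v) U ` E_space p = E_space (U *v p)"
  proof
    show "(*v) U ` E_space p \<subseteq> E_space (U *v p)"
      by (auto simp: E_space_eq herm_unitary[OF U])
  next
    have "v \<in> (*v) U ` E_space p" if "v \<in> E_space (U *v p)" for v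
    proof -
      have "v = U *v (conj_transpose U *v v)"
        using U by (simp add: unitary_def matrix_vector_mul_assoc)
      then show ?thesis
        using that herm_unitary[OF U, of "conj_transpose U *v v" p] by (auto simp: E_space_eq)
    qed
    then show "E_space (U *v p) \<subseteq> (*v) U ` E_space p" by blast
  qed
  moreover have "vec.span ((*v) U ` S) = (*v) U ` vec.span S" for S
    by (rule vec.linear_span_image[OF matrix_vector_mul_linear_gen])
  ultimately show ?thesis
    using f by (simp add: orthonormal_basis_E_def herm_unitary[OF U] image_image[symmetric, of "(*v) U" f])
qed

section \<open>The invariant form at one point\<close>

lemma orthonormal_expansion_real:
  assumes f: "orthonormal_basis_E p f" and v: "v \<in> E_space p"
  shows "v = (\<Sum>k<CARD('n) - 1. (f k \<bullet> v) *\<^sub>R f k + ((\<i> *s f k) \<bullet> v) *\<^sub>R (\<i> *s (f k :: complex^'n)))"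
proof -
  \<comment> \<open>The real inner products with \<open>f k\<close> and \<open>\<i> *s f k\<close>
    are the real and imaginary parts of \<open>herm v (f k)\<close>.\<close>
  have "herm v (f k) *s f k = (f k \<bullet> v) *\<^sub>R f k + ((\<i> *s f k) \<bullet> v) *\<^sub>R (\<i> *s f k)" for k
    by (simp add: inner_eq_Re_herm herm_smult_right vec_eq_iff complex_eq_iff)
  then show ?thesis
    using orthonormal_expansion[OF f v] by simp
qed

text \<open>The vectors \<open>f j\<close> and \<open>\<i> *s f j\<close> span
  \<open>E_space p\<close> over the reals, so expanding both arguments determines the form.\<close>

lemma bilinear_eq_symplectic:
  fixes \<Omega> :: "complex^'n \<Rightarrow> complex^'n \<Rightarrow> real"
  assumes \<Omega>: "bilinear \<Omega>" "\<And>v w. \<Omega> v w = - \<Omega> w v" and f: "orthonormal_basis_E p f"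
    and ff: "\<And>j k. j < CARD('n) - 1 \<Longrightarrow> k < CARD('n) - 1 \<Longrightarrow> \<Omega> (f j) (f k) = 0"
    and ifif: "\<And>j k. j < CARD('n) - 1 \<Longrightarrow> k < CARD('n) - 1 \<Longrightarrow> \<Omega> (\<i> *s f j) (\<i> *s f k) = 0"
    and fif: "\<And>j k. j < CARD('n) - 1 \<Longrightarrow> k < CARD('n) - 1 \<Longrightarrow>
      \<Omega> (f j) (\<i> *s f k) = (if j = k then c else 0)"
    and v: "v \<in> E_space p" and w: "w \<in> E_space p"
  shows "\<Omega> v w = c * (\<Sum>j<CARD('n) - 1. (f j \<bullet> v) * ((\<i> *s f j) \<bullet> w) - ((\<i> *s f j) \<bullet> v) * (f j \<bullet> w))"
proof -
  let ?I = "{..<CARD('n) - 1}"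
  have l: "linear (\<Omega> x)" and r: "linear (\<lambda>x. \<Omega> x y)" for x y
    using \<Omega>(1) by (simp_all add: bilinear_def)
  note expand = bilinear_radd[OF \<Omega>(1)] bilinear_rmul[OF \<Omega>(1)] linear_sum[OF l]
  have 1: "\<Omega> (f j) w = c * ((\<i> *s f j) \<bullet> w)" if "j < CARD('n) - 1" for j
  proof -
    have "\<Omega> (f j) w = (\<Sum>k\<in>?I. if j = k then c * ((\<i> *s f k) \<bullet> w) else 0)"
      by (subst orthonormal_expansion_real[OF f w], unfold expand, intro sum.cong)
        (use that in \<open>auto simp: ff fif\<close>)
    then show ?thesis using that by simp
  qed
  have 2: "\<Omega> (\<i> *s f j) w = - c * (f j \<bullet> w)" if "j < CARD('n) - 1" for j
  proof -
    have "\<Omega> (\<i> *s f j) w = (\<Sum>k\<in>?I. if j = k then - c * (f k \<bullet> w) else 0)"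
      by (subst orthonormal_expansion_real[OF f w], unfold expand, intro sum.cong)
        (use that in \<open>auto simp: ifif fif \<Omega>(2)[of "\<i> *s f j" "f _"]\<close>)
    then show ?thesis using that by simp
  qed
  have "\<Omega> v w = (\<Sum>j\<in>?I. (f j \<bullet> v) * \<Omega> (f j) w + ((\<i> *s f j) \<bullet> v) * \<Omega> (\<i> *s f j) w)"
    by (subst orthonormal_expansion_real[OF f v])
      (simp add: linear_sum[OF r] bilinear_ladd[OF \<Omega>(1)] bilinear_lmul[OF \<Omega>(1)])
  also have "\<dots> = c * (\<Sum>j\<in>?I. (f j \<bullet> v) * ((\<i> *s f j) \<bullet> w) - ((\<i> *s f j) \<bullet> v) * (f j \<bullet> w))"
    by (simp add: 1 2 sum_distrib_left algebra_simps)
  finally show ?thesis .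
qed

text \<open>The factor is written through \<open>\<tau>\<close> and test functions, rather than
  through the form, so that a unitary matrix can carry it to another point.\<close>

lemma SU_invariant_bivector_at:
  fixes \<tau> :: "'n::finite cproj \<Rightarrow> 'n bivec" and p :: "complex^'n"
  assumes inv: "SU_invariant \<tau>" and \<tau>: "\<tau> (phi p) \<in> bivectors_at (phi p)" and p: "norm p = 1"
    and f: "orthonormal_basis_E p f"
  shows "\<tau> (phi p) F G =
    \<tau> (phi p) (herm_fun p (f 0)) (herm_fun p (\<i> *s f 0)) * canonical_bivector (phi p) F G"
proof -
  obtain \<Omega> where \<Omega>: "bilinear \<Omega>" "\<And>v w. \<Omega> v w = - \<Omega> w v"
    and b: "\<And>F G. \<tau> (phi p) F G = \<Omega> (grad p F) (grad p G)"
    using bivector_bilinear_form[OF p \<tau>] by metis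
  have b_herm_fun: "\<tau> (phi p) (herm_fun p v) (herm_fun p w) = \<Omega> v w"
    if "v \<in> E_space p" "w \<in> E_space p" for v w
    by (simp add: b grad_herm_fun[OF p] that)
  \<comment> \<open>A unitary matrix fixing \<open>p\<close> preserves \<open>E_space p\<close>, so
    it sends test functions with gradients \<open>v\<close>, \<open>w\<close> to ones with gradients
    \<open>U *v v\<close>, \<open>U *v w\<close>.\<close>
  have \<Omega>_unitary: "\<Omega> (U *v v) (U *v w) = \<Omega> v w"
    if U: "unitary U" "U *v p = p" and vw: "v \<in> E_space p" "w \<in> E_space p" for U v w
  proof -
    have "U *v u \<in> E_space p" if "u \<in> E_space p" for u
      using that herm_unitary[OF U(1), of u p] by (simp add: E_space_eq U(2))
    then show ?thesis
      using SU_invariant_herm_fun[OF inv U(1) p, of p v p w] vw by (simp add: U(2) b_herm_fun)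
  qed
  let ?m = "CARD('n) - 1"
  have fE: "f j \<in> E_space p" "\<i> *s f j \<in> E_space p" if "j < ?m" for j
    using f that vec.span_superset[of "f ` {..<?m}"]
    by (auto simp: orthonormal_basis_E_def E_space_eq herm_smult_left)
  have herm_f: "herm (f j) (f k) = (if j = k then 1 else 0)" if "j < ?m" "k < ?m" for j k
    using f that by (simp add: orthonormal_basis_E_def)
  have norm_f: "norm (f j) = 1" if "j < ?m" for j
  proof -
    have "(norm (f j))\<^sup>2 = 1"
      using herm_f[OF that that] herm_self[of "f j"] by (metis of_real_eq_1_iff)
    then show ?thesis by (simp add: power2_eq_1_iff) (use norm_ge_zero[of "f j"] in linarith)
  qed
  have pE: "herm p v = 0" if "v \<in> E_space p" for v
    using that by (subst herm_commute) (simp add: E_space_eq)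
  have skew0: "\<Omega> v v = 0" for v using \<Omega>(2)[of v v] by simp
  \<comment> \<open>The scalar \<open>a\<close> covers \<open>f j\<close> and
    \<open>\<i> *s f j\<close> at once. The reflection negates \<open>v\<close> but fixes
    \<open>w\<close> and \<open>p\<close>.\<close>
  have off: "\<Omega> v w = 0" if j: "j < ?m" and v: "v = a *s f j" and w: "w \<in> E_space p" "herm w (f j) = 0"
    for j v w a
  proof -
    let ?R = "reflection (f j)"
    have "?R *v v = - v" "?R *v w = w" "?R *v p = p"
      using herm_f[OF j j] w(2) pE[OF fE(1)[OF j]]
      by (simp_all add: reflection_mult_vec v herm_smult_left vec_eq_iff)
    moreover have "v \<in> E_space p"
      using fE(1)[OF j] by (simp add: v E_space_eq herm_smult_left)
    ultimately have "\<Omega> (- v) w = \<Omega> v w"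
      using \<Omega>_unitary[of ?R v w] unitary_reflection[of "f j"] norm_f[OF j] w(1) by simp
    then show ?thesis by (simp add: bilinear_lneg[OF \<Omega>(1)])
  qed
  have diag: "\<Omega> (f j) (\<i> *s f j) = \<Omega> (f 0) (\<i> *s f 0)" if j: "j < ?m" for j
  proof -
    let ?R = "reflection (sgn (f 0 - f j))"
    have 0: "0 < ?m" using j by simp
    \<comment> \<open>\<open>herm (f 0) (f j)\<close> is 0 or 1, hence real; for
      \<open>j = 0\<close> the reflection is the identity.\<close>
    have R: "?R *v f 0 = f j"
      by (rule reflection_swap) (use norm_f j 0 herm_f in auto)
    then have "?R *v (\<i> *s f 0) = \<i> *s f j"
      by (simp add: vec.linear_scale[OF matrix_vector_mul_linear_gen])
    moreover have "?R *v p = p"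
      using pE[OF fE(1)[OF 0]] pE[OF fE(1)[OF j]]
      by (simp add: reflection_mult_vec sgn_div_norm herm_scaleR_right herm_diff_right)
    ultimately show ?thesis
      using \<Omega>_unitary[OF unitary_reflection[OF norm_sgn_cases, of "f 0 - f j"]] R fE[OF 0] by metis
  qed
  have "\<tau> (phi p) F G = \<Omega> (f 0) (\<i> *s f 0) * canonical_at p f F G"
    unfolding b canonical_at_def wedge_def Dphi_eq_inner_grad[OF p]
  proof (rule bilinear_eq_symplectic[OF \<Omega> f _ _ _ grad_in_E_space[OF p] grad_in_E_space[OF p]])
    fix j k assume jk: "j < ?m" "k < ?m"
    show "\<Omega> (f j) (f k) = 0"
      using skew0 off[of j "f j" 1 "f k"] jk fE(1)[OF jk(2)] herm_f[OF jk(2) jk(1)]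
      by (cases "j = k") simp_all
    show "\<Omega> (\<i> *s f j) (\<i> *s f k) = 0"
      using skew0 off[of j "\<i> *s f j" \<i> "\<i> *s f k"] jk fE(2)[OF jk(2)] herm_f[OF jk(2) jk(1)]
      by (cases "j = k") (simp_all add: herm_smult_left)
    show "\<Omega> (f j) (\<i> *s f k) = (if j = k then \<Omega> (f 0) (\<i> *s f 0) else 0)"
    proof (cases "j = k")
      case True
      then show ?thesis using diag[OF jk(1)] by simp
    next
      case False
      then show ?thesis
        using off[of j "f j" 1 "\<i> *s f k"] jk fE(2)[OF jk(2)] herm_f[OF jk(2) jk(1)]
        by (simp add: herm_smult_left)
    qed
  qed
  \<comment> \<open>For \<open>?m = 0\<close> the vector \<open>f 0\<close> is unconstrained and its
    two factors cannot be compared; both sides of the claim are then 0.\<close>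
  moreover have "canonical_at p f F G = 0" if "?m = 0"
    using that by (simp add: canonical_at_def)
  moreover have "\<Omega> (f 0) (\<i> *s f 0) = \<tau> (phi p) (herm_fun p (f 0)) (herm_fun p (\<i> *s f 0))" if "?m \<noteq> 0"
    using fE[of 0] that by (simp add: b_herm_fun)
  ultimately show ?thesis
    unfolding canonical_bivector_phi[OF p f] by (cases "?m = 0") auto
qed

theorem mainTheorem4:
  fixes \<tau> :: "'n::finite cproj \<Rightarrow> 'n bivec"
  assumes "CARD('n) \<ge> 2"
    and "bivector_field \<tau>"
    and "SU_invariant \<tau>"
  shows "\<exists>c::real. \<forall>x. \<tau> x = (\<lambda>f g. c * canonical_bivector x f g)"
proof -
  define p where "p = (axis undefined 1 :: complex^'n)"
  have p: "norm p = 1" by (simp add: p_def norm_axis_1)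
  obtain f where f: "orthonormal_basis_E p f"
    using orthonormal_basis_E_axis by (auto simp: p_def)
  \<comment> \<open>The factor at the base point \<open>p\<close>.\<close>
  define c where "c = \<tau> (phi p) (herm_fun p (f 0)) (herm_fun p (\<i> *s f 0))"
  have "\<tau> x F G = c * canonical_bivector x F G" for x F G
  proof -
    obtain U where U: "unitary U" "phi (U *v p) = x"
      using transitive_unitary[OF p] by blast
    have "\<tau> x \<in> bivectors_at x"
      using assms(2) by (simp add: bivector_field_def)
    \<comment> \<open>The pointwise result is applied at \<open>U *v p\<close> with the transported
      basis; invariance under \<open>U\<close> then identifies its factor with
      \<open>c\<close>.\<close>
    then have "\<tau> x F G = \<tau> x (herm_fun (U *v p) (U *v f 0)) (herm_fun (U *v p) (\<i> *s (U *v f 0)))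
        * canonical_bivector x F G"
      using SU_invariant_bivector_at[OF assms(3) _ _ orthonormal_basis_E_unitary[OF f U(1)], of F G]
      by (simp add: U(2) norm_unitary[OF U(1)] p)
    also have "\<i> *s (U *v f 0) = U *v (\<i> *s f 0)"
      by (simp add: vec.linear_scale[OF matrix_vector_mul_linear_gen])
    also have "\<tau> x (herm_fun (U *v p) (U *v f 0)) (herm_fun (U *v p) (U *v (\<i> *s f 0))) = c"
      unfolding c_def U(2)[symmetric] by (rule SU_invariant_herm_fun[OF assms(3) U(1) p])
    finally show ?thesis .
  qed
  then show ?thesis by (intro exI[of _ c] allI ext)
qed

end
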